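(* Fix a staggered mesh with periodic boundary conditions, $\Delta t>0$ and constants $c_0,c_h\in\mathbb{R}$, $\tau\in(0,+\infty]$, and let $(T_p^n,\mathbf{J}_c^n,\boldsymbol{\psi}_p^n,\varphi_c^n)_{n\ge0}$ satisfy the scheme $$T_p^{n+1}=T_p^n-c_0\Delta t\,\nabla_p^c\cdot\mathbf{J}_c^{n+\frac12},$$ $$\mathbf{J}_c^{n+1}=\mathbf{J}_c^n-c_0\Delta t\,\nabla_c^pT_p^{n+\frac12}-c_h\Delta t\,\nabla_c^p\times\boldsymbol{\psi}_p^{n+\frac12}-\frac{\Delta t}{\tau}\mathbf{J}_c^{n+\frac12},$$ $$\boldsymbol{\psi}_p^{n+1}=\boldsymbol{\psi}_p^n+c_h\Delta t\,\nabla_p^c\times\mathbf{J}_c^{n+\frac12}-c_h\Delta t\,\nabla_p^c\varphi_c^{n+\frac12},$$ $$\varphi_c^{n+1}=\varphi_c^n-c_h\Delta t\,\nabla_c^p\cdot\boldsymbol{\psi}_p^{n+\frac12}.$$ Let $$\mathrm{E}_T^n=\frac12\sum_c|\Omega_c|\,\big\|\nabla_c^pT_p^n\big\|^2+\frac12\sum_p|\Omega_p|\,\big|\nabla_p^c\cdot\mathbf{J}_c^n\big|^2$$ be the discrete grad-div energy. Then: (a) if $\tau<+\infty$, it is dissipated: $$\mathrm{E}_T^{n+1}-\mathrm{E}_T^n=-\frac{\Delta t}{\tau}\sum_p|\Omega_p|\,\big|\nabla_p^c\cdot\mathbf{J}_c^{n+\frac12}\big|^2\le0\qquad\forall n\ge0;$$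 (b) in the limit $\tau\to\infty$ ($1/\tau=0$), it is exactly conserved: $\mathrm{E}_T^n=\mathrm{E}_T^0$ for all $n\ge0$.
   Context: Staggered mesh: the domain $\Omega$ is covered by finitely many primal cells $\Omega_c$ (indexed by $c$, centers $\mathbf{x}_c$) and by dual cells $\Omega_p$ (indexed by the primal vertices $p$, centers $\mathbf{x}_p$) obtained by connecting neighboring primal cell centers; $|\Omega_c|,|\Omega_p|>0$ are their measures. Write $p\in\Omega_c$ iff $p$ is a vertex of $\Omega_c$; this is equivalent to $c\in\Omega_p$. With periodic boundary conditions the mesh is identified periodically and there are no boundary contributions. For each incident pair $(c,p)$, $l_{pc}\mathbf{n}_{pc}$ is the corner vector: the integral of the unit normal outward to $\Omega_c$ over the part of $\partial\Omega_c$ consisting of the half-edges of $\Omega_c$ adjacent to $p$ (viewed as a vector in $\mathbb{R}^3$, with vanishing third component for two-dimensional meshes), with $l_{pc}\ge0$, and $\mathbf{n}_{cp}=-\mathbf{n}_{pc}$. One has $\sum_{p\in\Omega_c}l_{pc}\mathbf{n}_{pc}=0$ and $\sum_{c\in\Omega_p}l_{pc}\mathbf{n}_{cp}=0$. Discrete operators, for $\star$ denoting multiplication by a scalar field (gradient), scalar product $\cdot$ with a vector field (divergence), or vector product $\times$ with a vector field (curl): $$(\nabla_c^p\star f_p)_c=\frac1{|\Omega_c|}\sum_{p\in\Omega_c}l_{pc}\mathbf{n}_{pc}\star f_p,\qquad(\nabla_p^c\star f_c)_p=\frac1{|\Omega_p|}\sum_{c\in\Omega_p}l_{pc}\mathbf{n}_{cp}\star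 f_c.$$ The meshes considered are such that the compatibility identities $\nabla_c^p\times\nabla_p^c\phi_c=0$, $\nabla_p^c\times\nabla_c^p\phi_p=0$, $\nabla_c^p\cdot(\nabla_p^c\times\mathbf{A}_c)=0$, $\nabla_p^c\cdot(\nabla_c^p\times\mathbf{A}_p)=0$ hold for all discrete fields (e.g. uniform Cartesian periodic meshes). Unknowns: $T_p^n\in\mathbb{R}$ and $\boldsymbol{\psi}_p^n\in\mathbb{R}^3$ live at the vertices $p$; $\mathbf{J}_c^n\in\mathbb{R}^3$ and $\varphi_c^n\in\mathbb{R}$ live at the cell centers $c$. A superscript $n+\frac12$ denotes the average of the values at $n$ and $n+1$. $\tau=+\infty$ ($1/\tau=0$) means the relaxation term is dropped (reversible scheme). $\|\cdot\|$ is the Euclidean norm. *)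

theory Defs
  imports "HOL-Analysis.Analysis" "HOL-Library.Extended_Real"
begin

text \<open>
  A mesh is represented by the data through which the discrete operators see it.  The finite
  types \<open>'c\<close> and \<open>'p\<close> index the primal cells and the primal vertices (equivalently, the dual cells)
  after the periodic identification, so there are no boundary terms.
  \<open>incident M c p\<close> stands for both \<open>p \<in> \<Omega>\<^sub>c\<close> and \<open>c \<in> \<Omega>\<^sub>p\<close>;
  \<open>area_c\<close> and \<open>area_p\<close> are the measures of the primal and dual cells;
  \<open>len M p c *\<^sub>R nrm M p c\<close> is the corner vector of the pair \<open>(c, p)\<close>, outward to the primal
  cell \<open>c\<close>.  Only its values at incident pairs matter.
\<close>

record ('c, 'p) mesh =
  incident :: "'c \<Rightarrow> 'p \<Rightarrow> bool"
  area_c :: "'c \<Rightarrow> real"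
  area_p :: "'p \<Rightarrow> real"
  len :: "'p \<Rightarrow> 'c \<Rightarrow> real"
  nrm :: "'p \<Rightarrow> 'c \<Rightarrow> real ^ 3"

definition verts_of :: "('c, 'p) mesh \<Rightarrow> 'c \<Rightarrow> 'p set" where
  "verts_of M c = {p. incident M c p}"

definition cells_of :: "('c, 'p) mesh \<Rightarrow> 'p \<Rightarrow> 'c set" where
  "cells_of M p = {c. incident M c p}"

definition nrm_cp :: "('c, 'p) mesh \<Rightarrow> 'c \<Rightarrow> 'p \<Rightarrow> real ^ 3" where
  "nrm_cp M c p = - nrm M p c"

text \<open>
  The generic operators \<open>(\<nabla>\<^sub>c\<^sup>p \<star> f\<^sub>p)\<^sub>c\<close> and \<open>(\<nabla>\<^sub>p\<^sup>c \<star> f\<^sub>c)\<^sub>p\<close>.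
  The suffix \<open>_c\<close> (resp. \<open>_p\<close>) of an operator says where its result lives: \<open>grad_c\<close>, \<open>div_c\<close>, \<open>curl_c\<close>
  act on vertex fields and yield cell fields, \<open>grad_p\<close>, \<open>div_p\<close>, \<open>curl_p\<close> the other way round.
\<close>

definition nabla_c ::
  "(real ^ 3 \<Rightarrow> 'f \<Rightarrow> 'g::real_vector) \<Rightarrow> ('c::finite, 'p::finite) mesh \<Rightarrow> ('p \<Rightarrow> 'f) \<Rightarrow> 'c \<Rightarrow> 'g" where
  "nabla_c star M f c =
     (1 / area_c M c) *\<^sub>R (\<Sum>p\<in>verts_of M c. star (len M p c *\<^sub>R nrm M p c) (f p))"

definition nabla_p ::
  "(real ^ 3 \<Rightarrow> 'f \<Rightarrow> 'g::real_vector) \<Rightarrow> ('c::finite, 'p::finite) mesh \<Rightarrow> ('c \<Rightarrow> 'f) \<Rightarrow> 'p \<Rightarrow> 'g" where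
  "nabla_p star M f p =
     (1 / area_p M p) *\<^sub>R (\<Sum>c\<in>cells_of M p. star (len M p c *\<^sub>R nrm_cp M c p) (f c))"

definition grad_c :: "('c::finite, 'p::finite) mesh \<Rightarrow> ('p \<Rightarrow> real) \<Rightarrow> 'c \<Rightarrow> real ^ 3" where
  "grad_c = nabla_c (\<lambda>v a. a *\<^sub>R v)"

definition div_c :: "('c::finite, 'p::finite) mesh \<Rightarrow> ('p \<Rightarrow> real ^ 3) \<Rightarrow> 'c \<Rightarrow> real" where
  "div_c = nabla_c inner"

definition curl_c :: "('c::finite, 'p::finite) mesh \<Rightarrow> ('p \<Rightarrow> real ^ 3) \<Rightarrow> 'c \<Rightarrow> real ^ 3" where
  "curl_c = nabla_c cross3"

definition grad_p :: "('c::finite, 'p::finite) mesh \<Rightarrow> ('c \<Rightarrow> real) \<Rightarrow> 'p \<Rightarrow> real ^ 3" where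
  "grad_p = nabla_p (\<lambda>v a. a *\<^sub>R v)"

definition div_p :: "('c::finite, 'p::finite) mesh \<Rightarrow> ('c \<Rightarrow> real ^ 3) \<Rightarrow> 'p \<Rightarrow> real" where
  "div_p = nabla_p inner"

definition curl_p :: "('c::finite, 'p::finite) mesh \<Rightarrow> ('c \<Rightarrow> real ^ 3) \<Rightarrow> 'p \<Rightarrow> real ^ 3" where
  "curl_p = nabla_p cross3"

definition staggered_mesh :: "('c::finite, 'p::finite) mesh \<Rightarrow> bool" where
  "staggered_mesh M \<longleftrightarrow>
     (\<forall>c. area_c M c > 0) \<and>
     (\<forall>p. area_p M p > 0) \<and>
     (\<forall>c p. incident M c p \<longrightarrow> len M p c \<ge> 0) \<and>
     (\<forall>c. (\<Sum>p\<in>verts_of M c. len M p c *\<^sub>R nrm M p c) = 0) \<and>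
     (\<forall>p. (\<Sum>c\<in>cells_of M p. len M p c *\<^sub>R nrm_cp M c p) = 0) \<and>
     (\<forall>\<phi> c. curl_c M (grad_p M \<phi>) c = 0) \<and>
     (\<forall>\<phi> p. curl_p M (grad_c M \<phi>) p = 0) \<and>
     (\<forall>A c. div_c M (curl_p M A) c = 0) \<and>
     (\<forall>A p. div_p M (curl_c M A) p = 0)"

definition half :: "(nat \<Rightarrow> 'i \<Rightarrow> 'a::real_vector) \<Rightarrow> nat \<Rightarrow> 'i \<Rightarrow> 'a" where
  "half f n i = (1 / 2) *\<^sub>R (f n i + f (Suc n) i)"

text \<open>
  The coefficient \<open>\<Delta>t / \<tau>\<close> for \<open>\<tau> \<in> (0, \<infinity>]\<close>.  Division is that of the extended reals, so the
  coefficient is \<open>0\<close> for \<open>\<tau> = \<infinity>\<close>, which drops the relaxation term.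
\<close>

definition relax :: "real \<Rightarrow> ereal \<Rightarrow> real" where
  "relax dt \<tau> = real_of_ereal (ereal dt / \<tau>)"

definition scheme ::
  "('c::finite, 'p::finite) mesh \<Rightarrow> real \<Rightarrow> real \<Rightarrow> real \<Rightarrow> ereal \<Rightarrow>
   (nat \<Rightarrow> 'p \<Rightarrow> real) \<Rightarrow> (nat \<Rightarrow> 'c \<Rightarrow> real ^ 3) \<Rightarrow>
   (nat \<Rightarrow> 'p \<Rightarrow> real ^ 3) \<Rightarrow> (nat \<Rightarrow> 'c \<Rightarrow> real) \<Rightarrow> bool" where
  "scheme M dt c0 ch \<tau> T J \<psi> \<phi> \<longleftrightarrow>
     (\<forall>n p. T (Suc n) p = T n p - c0 * dt * div_p M (half J n) p) \<and>
     (\<forall>n c. J (Suc n) c = J n c - (c0 * dt) *\<^sub>R grad_c M (half T n) c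
                                - (ch * dt) *\<^sub>R curl_c M (half \<psi> n) c
                                - relax dt \<tau> *\<^sub>R half J n c) \<and>
     (\<forall>n p. \<psi> (Suc n) p = \<psi> n p + (ch * dt) *\<^sub>R curl_p M (half J n) p
                                - (ch * dt) *\<^sub>R grad_p M (half \<phi> n) p) \<and>
     (\<forall>n c. \<phi> (Suc n) c = \<phi> n c - ch * dt * div_c M (half \<psi> n) c)"

definition graddiv_energy ::
  "('c::finite, 'p::finite) mesh \<Rightarrow> ('p \<Rightarrow> real) \<Rightarrow> ('c \<Rightarrow> real ^ 3) \<Rightarrow> real" where
  "graddiv_energy M T J =
     1 / 2 * (\<Sum>c\<in>UNIV. area_c M c * (norm (grad_c M T c))\<^sup>2) +
     1 / 2 * (\<Sum>p\<in>UNIV. area_p M p * \<bar>div_p M J p\<bar>\<^sup>2)"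

end

theory Submission
  imports Defs
begin

text \<open>
  The discrete gradient and minus the discrete divergence are adjoint for the inner products
  weighted by the cell measures.  Apply \<open>\<nabla>\<^sub>c\<^sup>p\<close> to the \<open>T\<close>-equation and \<open>\<nabla>\<^sub>p\<^sup>c\<cdot>\<close> to the
  \<open>J\<close>-equation (the curl term vanishes by compatibility), and test with the midpoint values
  \<open>\<nabla>\<^sub>c\<^sup>pT\<close> and \<open>\<nabla>\<^sub>p\<^sup>c\<cdot>J\<close>: the wave terms cancel by adjointness, and only the relaxation term
  remains.
\<close>

lemma grad_c_add: "grad_c M (\<lambda>p. f p + g p) c = grad_c M f c + grad_c M g c"
  by (simp add: grad_c_def nabla_c_def distrib_right scaleR_add_left sum.distrib scaleR_add_right)

lemma grad_c_mult: "grad_c M (\<lambda>p. k * f p) c = k *\<^sub>R grad_c M f c"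
  by (simp add: grad_c_def nabla_c_def scaleR_right.sum mult_ac)

lemma div_p_add: "div_p M (\<lambda>c. f c + g c) p = div_p M f p + div_p M g p"
  by (simp add: div_p_def nabla_p_def inner_add_right sum.distrib ring_distribs add_divide_distrib)

lemma div_p_scaleR: "div_p M (\<lambda>c. k *\<^sub>R f c) p = k * div_p M f p"
  by (simp add: div_p_def nabla_p_def sum_distrib_left sum_divide_distrib mult_ac)

lemma grad_c_half: "grad_c M (half T n) c = (1/2) *\<^sub>R (grad_c M (T n) c + grad_c M (T (Suc n)) c)"
proof -
  have "half T n = (\<lambda>p. (1/2) * (T n p + T (Suc n) p))"
    by (simp add: half_def fun_eq_iff)
  then show ?thesis
    by (simp only: grad_c_mult grad_c_add)
qed

lemma div_p_half: "div_p M (half J n) p = (1/2) * (div_p M (J n) p + div_p M (J (Suc n)) p)"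
proof -
  have "half J n = (\<lambda>c. (1/2) *\<^sub>R (J n c + J (Suc n) c))"
    by (simp add: half_def fun_eq_iff)
  then show ?thesis
    by (simp only: div_p_scaleR div_p_add)
qed

text \<open>Summation by parts: each cell measure cancels the inverse measure in its operator, so
  both sides become one double sum over incident pairs, ordered by cells or by vertices. The sign
  comes from \<open>nrm_cp\<close> being minus \<open>nrm\<close>; periodicity leaves no boundary
  terms.\<close>

lemma grad_c_div_p_adjoint:
  assumes "staggered_mesh M"
  shows "(\<Sum>c\<in>UNIV. area_c M c * (grad_c M u c \<bullet> v c)) = - (\<Sum>p\<in>UNIV. area_p M p * (u p * div_p M v p))"
proof -
  have ac: "area_c M c \<noteq> 0" and ap: "area_p M p \<noteq> 0" for c p
    using assms unfolding staggered_mesh_def by (metis less_irrefl)+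
  let ?w = "\<lambda>p c. u p * (len M p c * (nrm M p c \<bullet> v c))"
  have "(\<Sum>c\<in>UNIV. area_c M c * (grad_c M u c \<bullet> v c)) = (\<Sum>c\<in>UNIV. \<Sum>p\<in>verts_of M c. ?w p c)"
    using ac by (simp add: grad_c_def nabla_c_def inner_sum_left mult_ac)
  also have "\<dots> = (\<Sum>p\<in>UNIV. \<Sum>c\<in>cells_of M p. ?w p c)"
    using sum.swap_restrict[of UNIV UNIV "\<lambda>c p. ?w p c" "incident M"]
    by (simp add: verts_of_def cells_of_def)
  also have "\<dots> = - (\<Sum>p\<in>UNIV. area_p M p * (u p * div_p M v p))"
    using ap by (simp add: div_p_def nabla_p_def nrm_cp_def sum_negf sum_distrib_left)
  finally show ?thesis .
qed

lemma scheme_grad_c_step: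
  assumes "scheme M dt c0 ch \<tau> T J \<psi> \<phi>"
  shows "grad_c M (T (Suc n)) c - grad_c M (T n) c = - ((c0 * dt) *\<^sub>R grad_c M (div_p M (half J n)) c)"
proof -
  \<comment> \<open>The update is stated as an equality of whole fields, so that a discrete operator
    can be applied to it. The minus sign sits in the scalar, the shape that
    \<open>grad_c_add\<close> and \<open>grad_c_mult\<close> rewrite.\<close>
  have "T (Suc n) = (\<lambda>p. T n p + (- (c0 * dt)) * div_p M (half J n) p)"
    using assms by (simp add: scheme_def fun_eq_iff)
  then have "grad_c M (T (Suc n)) c
      = grad_c M (T n) c + (- (c0 * dt)) *\<^sub>R grad_c M (div_p M (half J n)) c"
    by (simp only: grad_c_add grad_c_mult)
  then show ?thesis
    by simp
qed

lemma scheme_div_p_step: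
  assumes "staggered_mesh M" "scheme M dt c0 ch \<tau> T J \<psi> \<phi>"
  shows "div_p M (J (Suc n)) p - div_p M (J n) p
    = - (c0 * dt) * div_p M (grad_c M (half T n)) p - relax dt \<tau> * div_p M (half J n) p"
proof -
  have "J (Suc n) = (\<lambda>c. J n c + ((- (c0 * dt)) *\<^sub>R grad_c M (half T n) c
      + ((- (ch * dt)) *\<^sub>R curl_c M (half \<psi> n) c + (- relax dt \<tau>) *\<^sub>R half J n c)))"
    using assms by (simp add: scheme_def fun_eq_iff algebra_simps)
  then have "div_p M (J (Suc n)) p = div_p M (J n) p
      + (- (c0 * dt) * div_p M (grad_c M (half T n)) p
      + (- (ch * dt) * div_p M (curl_c M (half \<psi> n)) p + (- relax dt \<tau>) * div_p M (half J n) p))"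
    by (simp only: div_p_add div_p_scaleR)
  moreover have "div_p M (curl_c M (half \<psi> n)) p = 0"
    using assms(1) by (simp add: staggered_mesh_def)
  ultimately show ?thesis
    by simp
qed

text \<open>This is the algebra of the midpoint rule, (a + b)/2 times (b - a) = (b^2 - a^2)/2,
  applied to gradients by cell and to divergences by vertex. It is why the midpoint values are the
  right test fields.\<close>

lemma graddiv_energy_diff:
  "graddiv_energy M (T (Suc n)) (J (Suc n)) - graddiv_energy M (T n) (J n)
    = (\<Sum>c\<in>UNIV. area_c M c * (grad_c M (half T n) c \<bullet> (grad_c M (T (Suc n)) c - grad_c M (T n) c)))
    + (\<Sum>p\<in>UNIV. area_p M p * (div_p M (half J n) p * (div_p M (J (Suc n)) p - div_p M (J n) p)))"
proof -
  have c: "area_c M c * (grad_c M (half T n) c \<bullet> (grad_c M (T (Suc n)) c - grad_c M (T n) c))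
    = 1/2 * (area_c M c * (norm (grad_c M (T (Suc n)) c))\<^sup>2) - 1/2 * (area_c M c * (norm (grad_c M (T n) c))\<^sup>2)" for c
    \<comment> \<open>After expansion only the mixed products of old and new gradients remain; they
      cancel by symmetry of the inner product.\<close>
    by (simp add: grad_c_half power2_norm_eq_inner inner_add_left inner_diff_right algebra_simps)
      (simp add: inner_commute)
  have p: "area_p M p * (div_p M (half J n) p * (div_p M (J (Suc n)) p - div_p M (J n) p))
    = 1/2 * (area_p M p * \<bar>div_p M (J (Suc n)) p\<bar>\<^sup>2) - 1/2 * (area_p M p * \<bar>div_p M (J n) p\<bar>\<^sup>2)" for p
    by (simp add: div_p_half power2_eq_square field_simps)
  show ?thesis
    unfolding c p graddiv_energy_def by (simp add: sum_subtractf sum_distrib_left)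
qed

text \<open>Keeping the coefficient as \<open>relax dt \<tau>\<close> lets one identity serve both
  the dissipative and the reversible case.\<close>

lemma graddiv_energy_step:
  assumes "staggered_mesh M" "scheme M dt c0 ch \<tau> T J \<psi> \<phi>"
  shows "graddiv_energy M (T (Suc n)) (J (Suc n)) - graddiv_energy M (T n) (J n)
    = - relax dt \<tau> * (\<Sum>p\<in>UNIV. area_p M p * \<bar>div_p M (half J n) p\<bar>\<^sup>2)"
proof -
  let ?G = "grad_c M (half T n)" and ?D = "div_p M (half J n)"
  have "(\<Sum>c\<in>UNIV. area_c M c * (?G c \<bullet> (grad_c M (T (Suc n)) c - grad_c M (T n) c)))
      = - (c0 * dt) * (\<Sum>c\<in>UNIV. area_c M c * (grad_c M ?D c \<bullet> ?G c))"
    unfolding scheme_grad_c_step[OF assms(2)]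
    by (simp add: sum_distrib_left sum_negf inner_commute mult_ac)
  \<comment> \<open>Adjointness is used with the midpoint divergence \<open>?D\<close> as the scalar
    field and the midpoint gradient \<open>?G\<close> as the vector field.\<close>
  also have "\<dots> = (c0 * dt) * (\<Sum>p\<in>UNIV. area_p M p * (?D p * div_p M ?G p))"
    by (simp add: grad_c_div_p_adjoint[OF assms(1)])
  finally have grad_part: "(\<Sum>c\<in>UNIV. area_c M c * (?G c \<bullet> (grad_c M (T (Suc n)) c - grad_c M (T n) c)))
      = (c0 * dt) * (\<Sum>p\<in>UNIV. area_p M p * (?D p * div_p M ?G p))" .
  \<comment> \<open>The first term on the right is the exact opposite of \<open>grad_part\<close>;
    the second is the dissipation.\<close>
  have div_part: "(\<Sum>p\<in>UNIV. area_p M p * (?D p * (div_p M (J (Suc n)) p - div_p M (J n) p)))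
      = - (c0 * dt) * (\<Sum>p\<in>UNIV. area_p M p * (?D p * div_p M ?G p))
        - relax dt \<tau> * (\<Sum>p\<in>UNIV. area_p M p * \<bar>?D p\<bar>\<^sup>2)"
    unfolding scheme_div_p_step[OF assms] sum_distrib_left sum_subtractf[symmetric]
    by (intro sum.cong refl) (simp add: power2_eq_square algebra_simps)
  show ?thesis
    unfolding graddiv_energy_diff grad_part div_part by simp
qed

theorem theorem4p4:
  fixes M :: "('c::finite, 'p::finite) mesh"
    and dt c0 ch :: real and \<tau> :: ereal
    and T :: "nat \<Rightarrow> 'p \<Rightarrow> real" and J :: "nat \<Rightarrow> 'c \<Rightarrow> real ^ 3"
    and \<psi> :: "nat \<Rightarrow> 'p \<Rightarrow> real ^ 3" and \<phi> :: "nat \<Rightarrow> 'c \<Rightarrow> real"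
  assumes "staggered_mesh M"
    and "dt > 0" and "\<tau> > 0"
    and "scheme M dt c0 ch \<tau> T J \<psi> \<phi>"
  shows "(\<tau> < \<infinity> \<longrightarrow>
            (\<forall>n. graddiv_energy M (T (Suc n)) (J (Suc n)) - graddiv_energy M (T n) (J n)
                  = - (dt / real_of_ereal \<tau>) * (\<Sum>p\<in>UNIV. area_p M p * \<bar>div_p M (half J n) p\<bar>\<^sup>2)
               \<and> - (dt / real_of_ereal \<tau>) * (\<Sum>p\<in>UNIV. area_p M p * \<bar>div_p M (half J n) p\<bar>\<^sup>2) \<le> 0))
       \<and> (\<tau> = \<infinity> \<longrightarrow>
            (\<forall>n. graddiv_energy M (T n) (J n) = graddiv_energy M (T 0) (J 0)))"
proof (intro conjI impI allI)
  note step = graddiv_energy_step[OF assms(1,4)]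
  {
    assume "\<tau> < \<infinity>"
    \<comment> \<open>Positivity rules out minus infinity, so \<tau> is a positive real and the
      extended division in \<open>relax\<close> is the ordinary one.\<close>
    with \<open>\<tau> > 0\<close> obtain r where r: "\<tau> = ereal r" "r > 0"
      by (cases \<tau>) auto
    then have "relax dt \<tau> = dt / real_of_ereal \<tau>"
      by (simp add: relax_def)
    with step show "graddiv_energy M (T (Suc n)) (J (Suc n)) - graddiv_energy M (T n) (J n)
        = - (dt / real_of_ereal \<tau>) * (\<Sum>p\<in>UNIV. area_p M p * \<bar>div_p M (half J n) p\<bar>\<^sup>2)" for n
      by simp
    have "area_p M p \<ge> 0" for p
      using assms(1) by (simp add: staggered_mesh_def less_imp_le)
    then have "(\<Sum>p\<in>UNIV. area_p M p * \<bar>div_p M (half J n) p\<bar>\<^sup>2) \<ge> 0" for n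
      by (intro sum_nonneg) simp
    moreover have "dt / real_of_ereal \<tau> \<ge> 0"
      using r \<open>dt > 0\<close> by simp
    ultimately show "- (dt / real_of_ereal \<tau>) * (\<Sum>p\<in>UNIV. area_p M p * \<bar>div_p M (half J n) p\<bar>\<^sup>2) \<le> 0" for n
      by (simp only: minus_mult_left[symmetric] neg_le_0_iff_le mult_nonneg_nonneg)
  next
    \<comment> \<open>Dividing a real by infinity gives 0 in the extended reals, so each step
      preserves the energy and induction reaches the initial time.\<close>
    assume "\<tau> = \<infinity>"
    then have "relax dt \<tau> = 0"
      by (simp add: relax_def)
    with step have "graddiv_energy M (T (Suc n)) (J (Suc n)) = graddiv_energy M (T n) (J n)" for n
      by simp
    then show "graddiv_energy M (T n) (J n) = graddiv_energy M (T 0) (J 0)" for n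
      by (induction n) simp_all
  }
qed

end
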